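(* Let $G$ be a finite group and let $R$ be its radical. (a) If $G/R$ is a direct product of non-Abelian simple groups, then there exists a conjugacy class of $G$ that generates $G$. (b) Suppose $C_p^d$ ($p$ prime, $d\ge 1$) is an elementary Abelian factor of highest dimension among all elementary Abelian factors in the direct product $G/R$; that is, writing $G/R\cong N\times\prod_{j=1}^{k}C_{p_j}^{d_j}$ with $N$ a direct product of non-Abelian simple groups, $k\ge 1$, the $p_j$ distinct primes and $d_j\geq 1$, one has $d=\max_j d_j$. Then $G$ is generated by $d$ conjugacy classes; furthermore, $d$ is the smallest number of conjugacy classes required to generate $G$.
   Context: The radical $R$ of $G$ is the intersection of all maximal normal subgroups of $G$ (a maximal normal subgroup is a maximal element among the proper normal subgroups of $G$); the quotient $G/R$ is a direct product of simple groups (groups of prime order counting as simple). $C_p$ is the cyclic group of order $p$. A set of conjugacy classes of $G$ is said to generate $G$ if the set of all elements lying in these classes generates $G$. Direct products may be empty (the trivial group). *)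

theory Defs
  imports "HOL-Algebra.Algebra" "HOL-Computational_Algebra.Primes"
begin

definition maximal_normal_subgroup :: "'a set \<Rightarrow> ('a, 'm) monoid_scheme \<Rightarrow> bool"
  where "maximal_normal_subgroup M G \<longleftrightarrow>
    M \<lhd> G \<and> M \<noteq> carrier G \<and>
    (\<forall>N. N \<lhd> G \<longrightarrow> N \<noteq> carrier G \<longrightarrow> M \<subseteq> N \<longrightarrow> N = M)"

text \<open>Intersecting with the carrier only matters if there is no maximal normal subgroup
  (in the finite case: if the group is trivial); the empty intersection is then the whole group.\<close>

definition radical :: "('a, 'm) monoid_scheme \<Rightarrow> 'a set"
  where "radical G = carrier G \<inter> \<Inter> {M. maximal_normal_subgroup M G}"

definition conjugacy_classes :: "('a, 'm) monoid_scheme \<Rightarrow> 'a set set"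
  where "conjugacy_classes G =
    orbits G (carrier G) (\<lambda>g. \<lambda>h \<in> carrier G. g \<otimes>\<^bsub>G\<^esub> h \<otimes>\<^bsub>G\<^esub> inv\<^bsub>G\<^esub> g)"

definition classes_generate :: "('a, 'm) monoid_scheme \<Rightarrow> 'a set set \<Rightarrow> bool"
  where "classes_generate G \<C> \<longleftrightarrow>
    \<C> \<subseteq> conjugacy_classes G \<and> generate G (\<Union> \<C>) = carrier G"

definition nonabelian_simple_group :: "('a, 'm) monoid_scheme \<Rightarrow> bool"
  where "nonabelian_simple_group S \<longleftrightarrow> simple_group S \<and> \<not> comm_group S"

definition elementary_abelian_group :: "nat \<Rightarrow> nat \<Rightarrow> (nat \<Rightarrow> int) monoid"
  where "elementary_abelian_group p d = product_group {..<d} (\<lambda>_. integer_mod_group p)"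

end

theory Submission
  imports Defs "HOL-Number_Theory.Cong"
begin

text \<open>
  A union of conjugacy classes generates a normal subgroup; if it is proper, it lies in a maximal
  normal subgroup, which contains \<open>R\<close>. So classes generate \<open>G\<close> as soon as the images of their
  elements lie in no proper normal subgroup of \<open>G/R\<close>. In \<open>G/R\<close>, take \<open>d\<close> elements whose
  components are noncentral in every non-Abelian simple factor, the \<open>t\<close>-th element having the
  \<open>t\<close>-th basis vector as its component in each elementary Abelian factor. Commutators with these
  elements yield every simple factor, and the Chinese remainder theorem separates the primes.
  Conversely, a conjugacy class maps to a single element of \<open>C\<^sub>p\<^sup>d\<close>, and \<open>m\<close> elements of an
  Abelian group of exponent \<open>p\<close> generate at most \<open>p\<^sup>m\<close> elements.
\<close>

section \<open>Normal subgroups and conjugacy classes\<close>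

lemma (in group_hom) subgroup_preimage:
  assumes "subgroup N H"
  shows "subgroup {x \<in> carrier G. h x \<in> N} G"
proof -
  interpret N: subgroup N H by fact
  show ?thesis
    by (rule G.subgroupI) auto
qed

lemma (in group_hom) normal_preimage:
  assumes "N \<lhd> H"
  shows "{x \<in> carrier G. h x \<in> N} \<lhd> G"
proof -
  interpret N: normal N H by fact
  show ?thesis
    by (rule G.normal_invI) (auto intro: subgroup_preimage N.subgroup_axioms N.inv_op_closed2)
qed

lemma conjugacy_classes_eq:
  "conjugacy_classes G =
    (\<lambda>x. {g \<otimes>\<^bsub>G\<^esub> x \<otimes>\<^bsub>G\<^esub> inv\<^bsub>G\<^esub> g | g. g \<in> carrier G}) ` carrier G"
  unfolding conjugacy_classes_def orbits_def orbit_def by force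

lemma (in group) radical_normal: "radical G \<lhd> G"
proof (rule normal_invI)
  \<comment> \<open>Inserting the carrier keeps the family nonempty, as the rule for intersections
    of subgroups requires, even if no maximal normal subgroup exists.\<close>
  have "radical G = \<Inter> (insert (carrier G) {M. maximal_normal_subgroup M G})"
    by (simp add: radical_def)
  moreover have "subgroup (\<Inter> (insert (carrier G) {M. maximal_normal_subgroup M G})) G"
    by (rule subgroups_Inter)
      (auto simp: maximal_normal_subgroup_def subgroup_self normal_imp_subgroup)
  ultimately show "subgroup (radical G) G"
    by simp
next
  fix x h
  assume "x \<in> carrier G" "h \<in> radical G"
  then show "x \<otimes> h \<otimes> inv x \<in> radical G"
    by (auto simp: radical_def maximal_normal_subgroup_def intro: normal.inv_op_closed2)
qed

text \<open>A finite group has only finitely many subsets, so among the proper normal subgroups some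
  maximal one lies above \<open>N\<close>.\<close>

lemma maximal_normal_subgroup_exists:
  assumes "finite (carrier G)" and "N \<lhd> G" and "N \<noteq> carrier G"
  obtains M where "maximal_normal_subgroup M G" and "N \<subseteq> M"
proof -
  let ?A = "{M. M \<lhd> G \<and> M \<noteq> carrier G}"
  have "?A \<subseteq> Pow (carrier G)"
    by (auto dest: normal_imp_subgroup subgroup.subset)
  then have "finite ?A"
    using assms(1) finite_subset by blast
  then obtain M where "M \<in> ?A" "N \<subseteq> M" "\<forall>K\<in>?A. M \<subseteq> K \<longrightarrow> M = K"
    using finite_has_maximal2[of ?A N] assms by blast
  then show thesis
    by (intro that[of M]) (auto simp: maximal_normal_subgroup_def)
qed

text \<open>This moves the whole question of generation to \<open>H\<close>. Were the subgroup
  generated by the classes proper, a maximal normal \<open>M\<close> would contain it. Then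
  \<open>h\<close> M\<open>is normal and contains\<close>h \<open>Y\<close>, hence is all of
  \<open>H\<close>; since \<open>M\<close> also contains the kernel, it would be all of
  \<open>G\<close>.\<close>

lemma (in group_hom) classes_generate_if_normal_closure:
  assumes fin: "finite (carrier G)"
    and surj: "h ` carrier G = carrier H"
    and ker: "kernel G H h \<subseteq> radical G"
    and Y: "Y \<subseteq> carrier G"
    and full: "\<And>N. N \<lhd> H \<Longrightarrow> h ` Y \<subseteq> N \<Longrightarrow> N = carrier H"
  shows "classes_generate G ((\<lambda>x. {g \<otimes> x \<otimes> inv g | g. g \<in> carrier G}) ` Y)"
proof -
  define U where "U = {g \<otimes> x \<otimes> inv g | g x. g \<in> carrier G \<and> x \<in> Y}"
  have U_union: "\<Union> ((\<lambda>x. {g \<otimes> x \<otimes> inv g | g. g \<in> carrier G}) ` Y) = U"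
    by (auto simp: U_def)
  have UG: "U \<subseteq> carrier G"
    using Y by (auto simp: U_def)
  have normal: "generate G U \<lhd> G"
  proof (rule G.normal_generateI[OF UG])
    fix u g
    assume "u \<in> U" and g: "g \<in> carrier G"
    then obtain a x where u: "u = a \<otimes> x \<otimes> inv a" "a \<in> carrier G" "x \<in> Y"
      by (auto simp: U_def)
    with g Y have "g \<otimes> u \<otimes> inv g = (g \<otimes> a) \<otimes> x \<otimes> inv (g \<otimes> a)"
      by (auto simp: G.inv_mult_group G.m_assoc subset_iff)
    then show "g \<otimes> u \<otimes> inv g \<in> U"
      using u g by (auto simp: U_def)
  qed
  have "generate G U = carrier G"
  proof (rule ccontr)
    assume "generate G U \<noteq> carrier G"
    then obtain M where M: "maximal_normal_subgroup M G" and sub: "generate G U \<subseteq> M"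
      using maximal_normal_subgroup_exists[OF fin normal] by blast
    have MG: "M \<lhd> G"
      using M by (simp add: maximal_normal_subgroup_def)
    interpret M: normal M G by (rule MG)
    have YM: "Y \<subseteq> M"
    proof
      fix x
      assume x: "x \<in> Y"
      then have "\<one> \<otimes> x \<otimes> inv \<one> = x"
        using Y by auto
      with x have "x \<in> U"
        unfolding U_def by (metis (mono_tags, lifting) G.one_closed mem_Collect_eq)
      then show "x \<in> M"
        using sub generate.incl by fast
    qed
    have "h ` M \<lhd> H"
      using M.surj_hom_normal_subgroup surj group_hom_axioms by blast
    then have img: "h ` M = carrier H"
      using full YM by blast
    have "carrier G \<subseteq> M"
    proof
      fix x
      assume x: "x \<in> carrier G"
      then obtain m where m: "m \<in> M" "h x = h m"
        using img surj by (metis imageE imageI)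
      \<comment> \<open>Elements with the same image differ by a kernel element, and the kernel lies
        in the radical, hence in \<open>M\<close>.\<close>
      then have "x \<otimes> inv m \<in> kernel G H h"
        using x M.subset by (auto simp: kernel_def)
      then have "x \<otimes> inv m \<in> M"
        using ker M by (auto simp: radical_def)
      then have "x \<otimes> inv m \<otimes> m \<in> M"
        using m by blast
      then show "x \<in> M"
        using x m by (simp add: G.m_assoc)
    qed
    then show False
      using M M.subset by (auto simp: maximal_normal_subgroup_def)
  qed
  then show ?thesis
    unfolding classes_generate_def U_union conjugacy_classes_eq using Y by auto
qed

section \<open>Coordinate embeddings into product groups\<close>

text \<open>The canonical injection of the \<open>i\<close>-th factor. Restricting to
  \<open>I\<close> makes its values extensional, as elements of \<open>product_group\<close> must
  be.\<close>

definition coord_embed :: "'i set \<Rightarrow> ('i \<Rightarrow> ('b, 'n) monoid_scheme) \<Rightarrow> 'i \<Rightarrow> 'b \<Rightarrow> 'i \<Rightarrow> 'b"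
  where "coord_embed I G i x = (\<lambda>j\<in>I. if j = i then x else \<one>\<^bsub>G j\<^esub>)"

lemma coord_embed_hom:
  assumes "\<And>j. j \<in> I \<Longrightarrow> group (G j)" and "i \<in> I"
  shows "coord_embed I G i \<in> hom (G i) (product_group I G)"
  using assms
  by (auto simp: hom_def coord_embed_def group.is_monoid intro!: restrict_ext)

lemma coord_embed_subgroup_eq_carrier:
  assumes grp: "\<And>i. i \<in> I \<Longrightarrow> group (G i)" and fin: "finite I"
    and H: "subgroup H (product_group I G)"
    and coord: "\<And>i x. i \<in> I \<Longrightarrow> x \<in> carrier (G i) \<Longrightarrow> coord_embed I G i x \<in> H"
  shows "H = carrier (product_group I G)"
proof
  interpret H: subgroup H "product_group I G" by fact
  \<comment> \<open>Induction on a finite set \<open>J\<close> outside which \<open>f\<close> is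
    trivial: splitting off the coordinate \<open>i\<close> leaves an element that is trivial outside
    the smaller set. Taking \<open>J = I\<close> gives the claim.\<close>
  have supported: "f \<in> H" if "finite J" "J \<subseteq> I" "f \<in> carrier (product_group I G)"
    "\<And>i. i \<in> I - J \<Longrightarrow> f i = \<one>\<^bsub>G i\<^esub>" for J f
    using that
  proof (induction J arbitrary: f rule: finite_induct)
    case empty
    then have "f = \<one>\<^bsub>product_group I G\<^esub>"
      by (auto simp: PiE_iff extensional_def)
    then show ?case
      using H.one_closed by (simp only:)
  next
    case (insert i J)
    let ?g = "f(i := \<one>\<^bsub>G i\<^esub>)"
    have i: "i \<in> I" and f: "f \<in> (\<Pi>\<^sub>E i\<in>I. carrier (G i))"
      using insert.prems by auto
    have g: "?g \<in> H"
      using insert.prems i f grp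
      by (intro insert.IH) (auto simp: PiE_iff extensional_def group.is_monoid)
    have fi: "coord_embed I G i (f i) \<in> H"
      using i f by (intro coord) auto
    have "f = coord_embed I G i (f i) \<otimes>\<^bsub>product_group I G\<^esub> ?g"
      using i f grp
      by (auto simp: fun_eq_iff coord_embed_def PiE_iff extensional_def group.is_monoid)
    then show ?case
      using H.m_closed[OF fi g] by simp
  qed
  show "carrier (product_group I G) \<subseteq> H"
    using supported[OF fin] by blast
qed (rule subgroup.subset[OF H])

lemma DirProd_embed_hom:
  assumes "group G" and "group H"
  shows "group_hom G (G \<times>\<times> H) (\<lambda>x. (x, \<one>\<^bsub>H\<^esub>))"
    and "group_hom H (G \<times>\<times> H) (\<lambda>x. (\<one>\<^bsub>G\<^esub>, x))"
  using assms
  by (auto simp: group_hom_def group_hom_axioms_def hom_def DirProd_group group.is_monoid)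

section \<open>Powers and projections in product groups\<close>

lemma pow_product_group:
  fixes n :: nat
  shows "x [^]\<^bsub>product_group I G\<^esub> n = (\<lambda>i\<in>I. x i [^]\<^bsub>G i\<^esub> n)"
  by (induction n) (auto intro!: restrict_ext)

lemma coord_proj_hom:
  assumes "i \<in> I"
  shows "(\<lambda>f. f i) \<in> hom (product_group I G) (G i)"
  using assms by (auto simp: hom_def)

lemma coord_proj_surj:
  assumes "\<And>j. j \<in> I \<Longrightarrow> group (G j)" and "i \<in> I"
  shows "(\<lambda>f. f i) ` carrier (product_group I G) = carrier (G i)"
proof
  show "(\<lambda>f. f i) ` carrier (product_group I G) \<subseteq> carrier (G i)"
    using assms by auto
  show "carrier (G i) \<subseteq> (\<lambda>f. f i) ` carrier (product_group I G)"
  proof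
    fix x
    assume x: "x \<in> carrier (G i)"
    show "x \<in> (\<lambda>f. f i) ` carrier (product_group I G)"
    proof (rule image_eqI[where x = "coord_embed I G i x"])
      show "x = coord_embed I G i x i"
        using assms by (simp add: coord_embed_def)
      show "coord_embed I G i x \<in> carrier (product_group I G)"
        using coord_embed_hom[of I G i] assms x by (auto simp: hom_def)
    qed
  qed
qed

section \<open>Normal closures\<close>

text \<open>The hypothesis \<open>conj\<close> says that conjugation by \<open>q\<close> acts on
  \<open>f y\<close> as conjugation by \<open>s\<close> acts on \<open>y\<close>. Hence
  \<open>f\<close> sends the commutator of \<open>s\<close> and \<open>y\<close> to the commutator
  of \<open>q\<close> and \<open>f y\<close>, which lies in \<open>N\<close>. The preimage of
  \<open>N\<close> is thus a nontrivial normal subgroup of the simple group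
  \<open>S\<close>.\<close>

lemma simple_factor_in_normal:
  assumes hom: "group_hom S Q f" and simple: "simple_group S"
    and N: "N \<lhd> Q" and q: "q \<in> N"
    and s: "s \<in> carrier S" "y \<in> carrier S" "s \<otimes>\<^bsub>S\<^esub> y \<noteq> y \<otimes>\<^bsub>S\<^esub> s"
    and conj: "q \<otimes>\<^bsub>Q\<^esub> f y = f (s \<otimes>\<^bsub>S\<^esub> y \<otimes>\<^bsub>S\<^esub> inv\<^bsub>S\<^esub> s) \<otimes>\<^bsub>Q\<^esub> q"
  shows "f ` carrier S \<subseteq> N"
proof -
  interpret group_hom S Q f by fact
  interpret S: simple_group S by fact
  interpret N: normal N Q by fact
  let ?K = "{x \<in> carrier S. f x \<in> N}"
  let ?c = "s \<otimes>\<^bsub>S\<^esub> y \<otimes>\<^bsub>S\<^esub> inv\<^bsub>S\<^esub> s \<otimes>\<^bsub>S\<^esub> inv\<^bsub>S\<^esub> y"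
  have qQ: "q \<in> carrier Q"
    using q by simp
  have "f (s \<otimes>\<^bsub>S\<^esub> y \<otimes>\<^bsub>S\<^esub> inv\<^bsub>S\<^esub> s) = q \<otimes>\<^bsub>Q\<^esub> f y \<otimes>\<^bsub>Q\<^esub> inv\<^bsub>Q\<^esub> q"
    using conj s qQ by (simp add: H.m_assoc)
  \<comment> \<open>The bracketing shows a product of \<open>q\<close> with a conjugate of its
    inverse; both lie in \<open>N\<close>.\<close>
  then have "f ?c = q \<otimes>\<^bsub>Q\<^esub> (f y \<otimes>\<^bsub>Q\<^esub> inv\<^bsub>Q\<^esub> q \<otimes>\<^bsub>Q\<^esub> inv\<^bsub>Q\<^esub> f y)"
    using s qQ by (simp add: H.m_assoc)
  then have "f ?c \<in> N"
    using q s N.inv_op_closed2[of "f y" "inv\<^bsub>Q\<^esub> q"] by simp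
  then have "?c \<in> ?K"
    using s by simp
  moreover have "?c \<noteq> \<one>\<^bsub>S\<^esub>"
  proof
    assume "?c = \<one>\<^bsub>S\<^esub>"
    then have "y = s \<otimes>\<^bsub>S\<^esub> y \<otimes>\<^bsub>S\<^esub> inv\<^bsub>S\<^esub> s"
      using s G.inv_solve_right[of "\<one>\<^bsub>S\<^esub>" "s \<otimes>\<^bsub>S\<^esub> y \<otimes>\<^bsub>S\<^esub> inv\<^bsub>S\<^esub> s" y] by simp
    then show False
      using s G.inv_solve_right[of y "s \<otimes>\<^bsub>S\<^esub> y" s] by simp
  qed
  ultimately have "?K = carrier S"
    using S.no_real_normal_subgroup[OF normal_preimage[OF N]] by blast
  then show ?thesis
    by blast
qed

lemma nonabelian_simple_groupD:
  assumes "nonabelian_simple_group S"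
  shows "simple_group S" and "group S"
    and "\<exists>s\<in>carrier S. \<exists>y\<in>carrier S. s \<otimes>\<^bsub>S\<^esub> y \<noteq> y \<otimes>\<^bsub>S\<^esub> s"
proof -
  show "simple_group S"
    using assms by (simp add: nonabelian_simple_group_def)
  then show "group S"
    by (rule simple_group.axioms(1))
  then show "\<exists>s\<in>carrier S. \<exists>y\<in>carrier S. s \<otimes>\<^bsub>S\<^esub> y \<noteq> y \<otimes>\<^bsub>S\<^esub> s"
    using assms by (auto simp: nonabelian_simple_group_def intro: group.group_comm_groupI)
qed

text \<open>The ambient group \<open>Q\<close> is \<open>P\<close> itself in part (a) and \<open>P \<times> A\<close> in part (b);
  \<open>q\<close> acts on the image of \<open>P\<close> as conjugation by \<open>s\<close>.\<close>

lemma nonabelian_product_in_normal: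
  fixes I :: "'i set" and S :: "'i \<Rightarrow> ('b, 'n) monoid_scheme"
  defines "P \<equiv> product_group I S"
  assumes fin: "finite I" and S: "\<And>i. i \<in> I \<Longrightarrow> nonabelian_simple_group (S i)"
    and s: "\<And>i. i \<in> I \<Longrightarrow> s i \<in> carrier (S i)"
      "\<And>i. i \<in> I \<Longrightarrow> \<exists>y\<in>carrier (S i). s i \<otimes>\<^bsub>S i\<^esub> y \<noteq> y \<otimes>\<^bsub>S i\<^esub> s i"
    and f: "group_hom P Q f" and N: "N \<lhd> Q" and q: "q \<in> N"
    and conj: "\<And>x y. x \<in> carrier P \<Longrightarrow> y \<in> carrier P \<Longrightarrow>
      (\<And>i. i \<in> I \<Longrightarrow> s i \<otimes>\<^bsub>S i\<^esub> x i = y i \<otimes>\<^bsub>S i\<^esub> s i) \<Longrightarrow>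
      q \<otimes>\<^bsub>Q\<^esub> f x = f y \<otimes>\<^bsub>Q\<^esub> q"
  shows "f ` carrier P \<subseteq> N"
proof -
  interpret f: group_hom P Q f by fact
  have grp: "group (S i)" if "i \<in> I" for i
    using S[OF that] by (rule nonabelian_simple_groupD)
  have "{x \<in> carrier P. f x \<in> N} = carrier P"
    unfolding P_def
  proof (rule coord_embed_subgroup_eq_carrier[OF grp fin])
    show "subgroup {x \<in> carrier (product_group I S). f x \<in> N} (product_group I S)"
      using f.subgroup_preimage[OF normal_imp_subgroup[OF N]] by (simp add: P_def)
  next
    fix i x
    assume i: "i \<in> I" and x: "x \<in> carrier (S i)"
    interpret Si: group "S i" by (rule grp[OF i])
    let ?e = "coord_embed I S i"
    have e: "?e \<in> hom (S i) P"
      unfolding P_def by (rule coord_embed_hom[OF grp i])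
    then have eP: "?e z \<in> carrier P" if "z \<in> carrier (S i)" for z
      using that by (auto simp: hom_def)
    obtain y where y: "y \<in> carrier (S i)" "s i \<otimes>\<^bsub>S i\<^esub> y \<noteq> y \<otimes>\<^bsub>S i\<^esub> s i"
      using s(2)[OF i] by blast
    have "group_hom (S i) Q (f \<circ> ?e)"
      using hom_compose[OF e f.homh] Si.group_axioms f.H.group_axioms
      by (simp add: group_hom_def group_hom_axioms_def)
    moreover have "q \<otimes>\<^bsub>Q\<^esub> (f \<circ> ?e) y =
        (f \<circ> ?e) (s i \<otimes>\<^bsub>S i\<^esub> y \<otimes>\<^bsub>S i\<^esub> inv\<^bsub>S i\<^esub> s i) \<otimes>\<^bsub>Q\<^esub> q"
      unfolding o_def
    proof (rule conj)
      fix j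
      assume j: "j \<in> I"
      interpret Sj: group "S j" by (rule grp[OF j])
      \<comment> \<open>For \<open>j = i\<close> both sides equal the product of \<open>s i\<close>
        and \<open>y\<close>; for every other \<open>j\<close> both sides equal
        \<open>s j\<close>.\<close>
      show "s j \<otimes>\<^bsub>S j\<^esub> ?e y j =
          ?e (s i \<otimes>\<^bsub>S i\<^esub> y \<otimes>\<^bsub>S i\<^esub> inv\<^bsub>S i\<^esub> s i) j \<otimes>\<^bsub>S j\<^esub> s j"
        using s(1)[OF j] y(1) j by (auto simp: coord_embed_def Si.m_assoc)
    qed (use s(1)[OF i] y eP in auto)
    ultimately have "(f \<circ> ?e) ` carrier (S i) \<subseteq> N"
      using simple_factor_in_normal[OF _ nonabelian_simple_groupD(1)[OF S[OF i]] N q s(1)[OF i] y]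
      by blast
    then show "?e x \<in> {x \<in> carrier (product_group I S). f x \<in> N}"
      using x eP by (auto simp: P_def)
  qed
  then show ?thesis
    by blast
qed

section \<open>Elementary Abelian groups and simultaneous basis vectors\<close>

lemma elementary_abelian_group_simps:
  "carrier (elementary_abelian_group p d) = (\<Pi>\<^sub>E t\<in>{..<d}. carrier (integer_mod_group p))"
  "group (elementary_abelian_group p d)"
  "comm_group (elementary_abelian_group p d)"
proof -
  show grp: "group (elementary_abelian_group p d)"
    by (simp add: elementary_abelian_group_def)
  show "comm_group (elementary_abelian_group p d)"
    by (rule group.group_comm_groupI[OF grp])
      (auto simp: elementary_abelian_group_def add.commute intro!: restrict_ext)
qed (simp add: elementary_abelian_group_def)

text \<open>The \<open>t\<close>-th generator carries the \<open>t\<close>-th basis vector in all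
  factors at once, and zero in factors of dimension at most \<open>t\<close>. As the primes are
  distinct, suitable multiples isolate a single factor. The embedding criterion is then applied
  twice: to the factors, and to the coordinates inside one factor.\<close>

lemma basis_vectors_generate:
  fixes J :: "'j set" and ps ds :: "'j \<Rightarrow> nat"
  defines "A \<equiv> product_group J (\<lambda>j. elementary_abelian_group (ps j) (ds j))"
  assumes fin: "finite J" and prime: "\<And>j. j \<in> J \<Longrightarrow> Factorial_Ring.prime (ps j)"
    and inj: "inj_on ps J" and d: "\<And>j. j \<in> J \<Longrightarrow> ds j \<le> d"
    and K: "subgroup K A"
    and basis: "\<And>t. t < d \<Longrightarrow> (\<lambda>j\<in>J. \<lambda>t'\<in>{..<ds j}. if t' = t then 1 else 0) \<in> K"
  shows "K = carrier A"
  unfolding A_def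
proof (rule coord_embed_subgroup_eq_carrier[OF elementary_abelian_group_simps(2) fin])
  let ?E = "\<lambda>j. elementary_abelian_group (ps j) (ds j)"
  interpret A: group A
    unfolding A_def by (simp add: elementary_abelian_group_simps)
  show "subgroup K (product_group J ?E)"
    using K by (simp add: A_def)
  fix j x
  assume j: "j \<in> J" and x: "x \<in> carrier (?E j)"
  have hom: "group_hom (?E j) A (coord_embed J ?E j)"
    unfolding A_def
    using coord_embed_hom[where G = ?E, OF elementary_abelian_group_simps(2) j]
    by (simp add: group_hom_def group_hom_axioms_def elementary_abelian_group_simps)
  have "{x \<in> carrier (?E j). coord_embed J ?E j x \<in> K} =
      carrier (product_group {..<ds j} (\<lambda>_. integer_mod_group (ps j)))"
  proof (rule coord_embed_subgroup_eq_carrier)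
    show "subgroup {x \<in> carrier (?E j). coord_embed J ?E j x \<in> K}
        (product_group {..<ds j} (\<lambda>_. integer_mod_group (ps j)))"
      using group_hom.subgroup_preimage[OF hom K] by (simp add: elementary_abelian_group_def)
  next
    fix t x
    assume t: "t \<in> {..<ds j}" and x: "x \<in> carrier (integer_mod_group (ps j))"
    let ?a = "\<lambda>j\<in>J. \<lambda>t'\<in>{..<ds j}. if t' = t then 1 else (0 :: int)"
    let ?e = "coord_embed {..<ds j} (\<lambda>_. integer_mod_group (ps j)) t x"
    \<comment> \<open>Modulus 0 would give the group of all integers; primality excludes it, so
      \<open>x\<close> is a residue.\<close>
    have xr: "0 \<le> x" "x < int (ps j)"
      using x prime_gt_0_nat[OF prime[OF j]] by (auto simp: carrier_integer_mod_group)
    have "\<forall>i\<in>J. \<forall>l\<in>J. i \<noteq> l \<longrightarrow> coprime (ps i) (ps l)"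
      using inj by (auto simp: inj_on_def intro!: primes_coprime prime)
    \<comment> \<open>The Chinese remainder theorem gives a multiplier that is \<open>x\<close>
      modulo \<open>ps j\<close> and 0 modulo all other primes.\<close>
    then have "\<exists>m. \<forall>l\<in>J. [m = (if l = j then nat x else 0)] (mod ps l)"
      by (rule chinese_remainder_nat[OF fin])
    then obtain m where m: "\<And>l. l \<in> J \<Longrightarrow> [m = (if l = j then nat x else 0)] (mod ps l)"
      by blast
    have mj: "int m mod int (ps j) = x"
    proof -
      have "m mod ps j = nat x"
        using m[OF j] xr by (simp add: cong_def)
      then show ?thesis
        using xr by (metis nat_0_le zmod_int)
    qed
    have ml: "int m mod int (ps l) = 0" if "l \<in> J" "l \<noteq> j" for l
      using m[OF that(1)] that(2) by (simp add: cong_def flip: zmod_int)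
    \<comment> \<open>The factors are additive, so the power is an \<open>m\<close>-fold multiple:
      the entry 1 becomes \<open>x\<close> in factor \<open>j\<close> and vanishes in the
      others.\<close>
    have "?a [^]\<^bsub>A\<^esub> m = coord_embed J ?E j ?e"
      using mj ml j
      by (auto simp: A_def elementary_abelian_group_def pow_product_group coord_embed_def
          intro!: restrict_ext)
    moreover have "?a [^]\<^bsub>A\<^esub> m \<in> K"
      using A.subgroup_int_pow_closed[OF K basis, of t "int m"] t d[OF j]
      by (simp add: int_pow_int)
    ultimately have "coord_embed J ?E j ?e \<in> K"
      by simp
    moreover have "?e \<in> carrier (?E j)"
      using coord_embed_hom[of "{..<ds j}" "\<lambda>_. integer_mod_group (ps j)" t] t x
      by (auto simp: hom_def elementary_abelian_group_def)
    ultimately show "?e \<in> {x \<in> carrier (?E j). coord_embed J ?E j x \<in> K}"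
      by simp
  qed auto
  then show "coord_embed J ?E j x \<in> K"
    using x by (auto simp: elementary_abelian_group_def)
qed

section \<open>The lower bound\<close>

text \<open>By commutativity, the product of the subgroup generated by \<open>x\<close> and the one
  generated by \<open>Y\<close> is a subgroup, so each new generator multiplies the order by at most
  \<open>ord x\<close>, a divisor of \<open>p\<close>.\<close>

lemma (in comm_group) card_generate_exponent:
  assumes exp: "\<And>x. x \<in> carrier G \<Longrightarrow> x [^] p = \<one>" and p: "0 < p"
    and fin: "finite (carrier G)" and Y: "finite Y" "Y \<subseteq> carrier G"
  shows "card (generate G Y) \<le> p ^ card Y"
  using Y
proof (induction Y)
  case empty
  then show ?case
    by (simp add: generate_empty)
next
  case (insert x Y)
  have x: "x \<in> carrier G" and Y: "Y \<subseteq> carrier G"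
    using insert.prems by auto
  have sub: "subgroup (generate G {x}) G" "subgroup (generate G Y) G"
    using x Y by (auto intro!: generate_is_subgroup)
  interpret A: subgroup "generate G {x}" G by (rule sub)
  interpret B: subgroup "generate G Y" G by (rule sub)
  have "insert x Y \<subseteq> generate G {x} <#> generate G Y"
  proof
    fix y
    assume y: "y \<in> insert x Y"
    then have "y = y \<otimes> \<one>" "y = \<one> \<otimes> y"
      using x Y by auto
    then show "y \<in> generate G {x} <#> generate G Y"
      using y unfolding set_mult_def
      by (auto intro!: A.one_closed B.one_closed intro: generate.incl)
  qed
  then have "generate G (insert x Y) \<subseteq> generate G {x} <#> generate G Y"
    by (rule generate_subgroup_incl[OF _ mult_subgroups[OF sub]])
  also have "generate G {x} <#> generate G Y =
      (\<lambda>(a, b). a \<otimes> b) ` (generate G {x} \<times> generate G Y)"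
    by (auto simp: set_mult_def)
  finally have sub: "generate G (insert x Y) \<subseteq>
      (\<lambda>(a, b). a \<otimes> b) ` (generate G {x} \<times> generate G Y)" .
  have fin': "finite (generate G {x} \<times> generate G Y)"
    using fin A.subset B.subset finite_subset by blast
  have "card (generate G (insert x Y)) \<le> card (generate G {x} \<times> generate G Y)"
    using card_mono[OF finite_imageI[OF fin'] sub] card_image_le[OF fin'] le_trans by blast
  also have "\<dots> = ord x * card (generate G Y)"
    using generate_pow_card[OF x] by (simp add: card_cartesian_product)
  also have "ord x \<le> p"
    using exp[OF x] pow_eq_id[OF x, of p] p by (simp add: dvd_imp_le)
  also have "p * card (generate G Y) \<le> p * p ^ card Y"
    using insert.IH[OF Y] by simp
  finally show ?case
    using insert.hyps by simp
qed

text \<open>Conjugate elements have equal images in an Abelian group, so each class contributes one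
  generator \<open>z C\<close> of \<open>H\<close>, and the bound for groups with
  \<open>p\<close>-th powers trivial applies.\<close>

lemma (in group_hom) classes_generate_card_ge:
  assumes comm: "comm_group H" and surj: "h ` carrier G = carrier H"
    and exp: "\<And>x. x \<in> carrier H \<Longrightarrow> x [^]\<^bsub>H\<^esub> p = \<one>\<^bsub>H\<^esub>" and p: "0 < p"
    and fin: "finite (carrier G)" and gen: "classes_generate G \<C>"
  shows "card (carrier H) \<le> p ^ card \<C>"
proof -
  interpret comm: comm_group H by fact
  have sub: "\<C> \<subseteq> conjugacy_classes G" and all: "generate G (\<Union>\<C>) = carrier G"
    using gen by (auto simp: classes_generate_def)
  have finC: "finite \<C>"
    using fin finite_subset[OF sub] by (simp add: conjugacy_classes_eq)
  have "\<forall>C\<in>\<C>. \<exists>z\<in>carrier H. h ` C \<subseteq> {z}"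
  proof
    fix C
    assume "C \<in> \<C>"
    then obtain x where x: "x \<in> carrier G" and C: "C = {g \<otimes> x \<otimes> inv g | g. g \<in> carrier G}"
      using sub by (auto simp: conjugacy_classes_eq)
    have "h (g \<otimes> x \<otimes> inv g) = h x" if "g \<in> carrier G" for g
      using x that by (simp add: comm.m_comm[of "h g"] H.m_assoc)
    then show "\<exists>z\<in>carrier H. h ` C \<subseteq> {z}"
      using x C by (intro bexI[of _ "h x"]) auto
  qed
  then obtain z where z: "\<And>C. C \<in> \<C> \<Longrightarrow> z C \<in> carrier H" "\<And>C. C \<in> \<C> \<Longrightarrow> h ` C \<subseteq> {z C}"
    by metis
  have UG: "\<Union>\<C> \<subseteq> carrier G"
    using sub by (auto simp: conjugacy_classes_eq subset_iff)
  have zH: "z ` \<C> \<subseteq> carrier H"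
    using z by auto
  have finH: "finite (carrier H)"
    using fin surj by (metis finite_imageI)
  have "carrier H = generate H (h ` \<Union>\<C>)"
    using generate_img[OF UG] all surj by simp
  also have "\<dots> \<subseteq> generate H (z ` \<C>)"
    using z(2) by (intro H.mono_generate) blast
  finally have "card (carrier H) \<le> card (generate H (z ` \<C>))"
    using finH H.generate_incl[OF zH] by (intro card_mono) (auto intro: finite_subset)
  also have "\<dots> \<le> p ^ card (z ` \<C>)"
    using finC zH by (intro comm.card_generate_exponent exp p finH) auto
  \<comment> \<open>Distinct classes may have the same image, hence only an inequality.\<close>
  also have "\<dots> \<le> p ^ card \<C>"
    using p card_image_le[OF finC, of z] by (intro power_increasing) auto
  finally show ?thesis .
qed

lemma elementary_abelian_group_pow:
  "x [^]\<^bsub>elementary_abelian_group p d\<^esub> p = \<one>\<^bsub>elementary_abelian_group p d\<^esub>"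
  by (auto simp: elementary_abelian_group_def pow_product_group)

lemma card_elementary_abelian_group:
  assumes "0 < p"
  shows "card (carrier (elementary_abelian_group p d)) = p ^ d"
  using assms
  by (simp add: elementary_abelian_group_simps card_PiE carrier_integer_mod_group)

section \<open>Generation by conjugacy classes\<close>

text \<open>Composing the projection with the isomorphism replaces the quotient by a surjection from
  \<open>G\<close> itself, the form in which both bounds use it.\<close>

lemma (in group) radical_quotient_hom:
  assumes "G Mod radical G \<cong> Q" and Q: "group Q"
  obtains h where "group_hom G Q h" "h ` carrier G = carrier Q" "kernel G Q h = radical G"
proof -
  interpret R: normal "radical G" G by (rule radical_normal)
  interpret M: group "G Mod radical G" by (rule R.factorgroup_is_group)
  obtain f where f: "f \<in> iso (G Mod radical G) Q"
    using assms(1) by (auto simp: is_iso_def)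
  define h where "h = f \<circ> (\<lambda>a. radical G #> a)"
  have f_hom: "f \<in> hom (G Mod radical G) Q" and bij: "bij_betw f (carrier (G Mod radical G)) (carrier Q)"
    using f by (auto simp: iso_def)
  interpret f: group_hom "G Mod radical G" Q f
    using f_hom Q M.group_axioms by (simp add: group_hom_def group_hom_axioms_def)
  have hom: "group_hom G Q h"
    using Group.hom_compose[OF R.r_coset_hom_Mod f_hom] Q is_group
    by (simp add: group_hom_def group_hom_axioms_def h_def)
  have surj: "h ` carrier G = carrier Q"
    using bij unfolding h_def image_comp[symmetric] carrier_FactGroup bij_betw_def by simp
  have "h x = \<one>\<^bsub>Q\<^esub> \<longleftrightarrow> x \<in> radical G" if x: "x \<in> carrier G" for x
  proof -
    have "radical G #> x \<in> carrier (G Mod radical G)"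
      using x by (simp add: carrier_FactGroup)
    then have "h x = \<one>\<^bsub>Q\<^esub> \<longleftrightarrow> radical G #> x = radical G"
      using bij M.one_closed f.hom_one unfolding h_def bij_betw_def inj_on_def by fastforce
    then show ?thesis
      using coset_join1[OF _ x] coset_join2[OF x] R.subgroup_axioms by metis
  qed
  then have "kernel G Q h = radical G"
    using R.subset by (auto simp: kernel_def)
  with hom surj show thesis
    by (rule that)
qed

text \<open>A single class suffices: that of a lift of an element with no central coordinate, since
  the normal closure of such an element contains every simple factor.\<close>

lemma nonabelian_case:
  fixes S :: "'i \<Rightarrow> ('b, 'n) monoid_scheme"
  assumes G: "group G" "finite (carrier G)"
    and I: "finite I" and S: "\<And>i. i \<in> I \<Longrightarrow> nonabelian_simple_group (S i)"
    and iso: "G Mod radical G \<cong> product_group I S"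
  shows "\<exists>C \<in> conjugacy_classes G. classes_generate G {C}"
proof -
  let ?P = "product_group I S"
  have grp: "group (S i)" if "i \<in> I" for i
    using S[OF that] by (rule nonabelian_simple_groupD)
  obtain s where s: "\<And>i. i \<in> I \<Longrightarrow> s i \<in> carrier (S i)"
      "\<And>i. i \<in> I \<Longrightarrow> \<exists>y\<in>carrier (S i). s i \<otimes>\<^bsub>S i\<^esub> y \<noteq> y \<otimes>\<^bsub>S i\<^esub> s i"
    using nonabelian_simple_groupD(3)[OF S] by metis
  have P: "group ?P"
    using grp by simp
  obtain h where h: "group_hom G ?P h" "h ` carrier G = carrier ?P" "kernel G ?P h = radical G"
    using group.radical_quotient_hom[OF G(1) iso P] by blast
  interpret h: group_hom G ?P h by fact
  have "restrict s I \<in> carrier ?P"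
    using s by simp
  then obtain g where g: "g \<in> carrier G" "h g = restrict s I"
    using h(2) by (metis imageE)
  have "classes_generate G ((\<lambda>x. {a \<otimes>\<^bsub>G\<^esub> x \<otimes>\<^bsub>G\<^esub> inv\<^bsub>G\<^esub> a | a. a \<in> carrier G}) ` {g})"
  proof (rule h.classes_generate_if_normal_closure)
    fix N
    assume N: "N \<lhd> ?P" "h ` {g} \<subseteq> N"
    have id: "group_hom ?P ?P (\<lambda>x. x)"
      using P by (simp add: group_hom_def group_hom_axioms_def hom_def)
    have "(\<lambda>x. x) ` carrier ?P \<subseteq> N"
      by (rule nonabelian_product_in_normal[OF I S s id N(1), of "restrict s I"])
        (use N(2) g in \<open>auto intro!: restrict_ext\<close>)
    then show "N = carrier ?P"
      using normal_imp_subgroup[OF N(1)] subgroup.subset by fastforce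
  qed (use G h g in auto)
  then show ?thesis
    by (auto simp: classes_generate_def)
qed

text \<open>The classes are those of lifts of the pairs \<open>(restrict s I, ?a t)\<close> for
  \<open>t < d\<close>. A normal subgroup containing these pairs contains the non-Abelian part;
  cancelling the first components then leaves the basis vectors, which generate the Abelian part.
  Lifts may be conjugate, so the count is only bounded by \<open>d\<close>.\<close>

lemma mixed_case_classes:
  fixes S :: "'i \<Rightarrow> ('b, 'n) monoid_scheme" and ps ds :: "'j \<Rightarrow> nat"
  assumes G: "group G" "finite (carrier G)"
    and I: "finite I" and S: "\<And>i. i \<in> I \<Longrightarrow> nonabelian_simple_group (S i)"
    and J: "finite J" and prime: "\<And>j. j \<in> J \<Longrightarrow> Factorial_Ring.prime (ps j)"
    and inj: "inj_on ps J" and d: "\<And>j. j \<in> J \<Longrightarrow> ds j \<le> d" and d0: "0 < d"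
    and iso: "G Mod radical G \<cong>
      product_group I S \<times>\<times> product_group J (\<lambda>j. elementary_abelian_group (ps j) (ds j))"
  shows "\<exists>\<C>. classes_generate G \<C> \<and> card \<C> \<le> d"
proof -
  let ?P = "product_group I S"
  let ?A = "product_group J (\<lambda>j. elementary_abelian_group (ps j) (ds j))"
  have grp: "group (S i)" if "i \<in> I" for i
    using S[OF that] by (rule nonabelian_simple_groupD)
  obtain s where s: "\<And>i. i \<in> I \<Longrightarrow> s i \<in> carrier (S i)"
      "\<And>i. i \<in> I \<Longrightarrow> \<exists>y\<in>carrier (S i). s i \<otimes>\<^bsub>S i\<^esub> y \<noteq> y \<otimes>\<^bsub>S i\<^esub> s i"
    using nonabelian_simple_groupD(3)[OF S] by metis
  interpret P: group ?P
    using grp by simp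
  interpret A: group ?A
    by (simp add: elementary_abelian_group_simps)
  have Q: "group (?P \<times>\<times> ?A)"
    by (rule DirProd_group[OF P.group_axioms A.group_axioms])
  obtain h where h: "group_hom G (?P \<times>\<times> ?A) h" "h ` carrier G = carrier (?P \<times>\<times> ?A)"
      "kernel G (?P \<times>\<times> ?A) h = radical G"
    using group.radical_quotient_hom[OF G(1) iso Q] by blast
  interpret h: group_hom G "?P \<times>\<times> ?A" h by fact
  let ?a = "\<lambda>t. \<lambda>j\<in>J. \<lambda>t'\<in>{..<ds j}. if t' = t then 1 else (0 :: int)"
  have sP: "restrict s I \<in> carrier ?P"
    using s by simp
  have aA: "?a t \<in> carrier ?A" for t
    using prime_gt_1_nat[OF prime]
    by (auto simp: elementary_abelian_group_simps carrier_integer_mod_group)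
  have "\<forall>t. \<exists>g. g \<in> carrier G \<and> h g = (restrict s I, ?a t)"
  proof
    fix t
    have "(restrict s I, ?a t) \<in> h ` carrier G"
      unfolding h(2) carrier_DirProd using sP aA by (rule SigmaI)
    then show "\<exists>g. g \<in> carrier G \<and> h g = (restrict s I, ?a t)"
      by (metis (no_types, lifting) imageE)
  qed
  from choice[OF this] obtain g
    where g: "\<And>t. g t \<in> carrier G" "\<And>t. h (g t) = (restrict s I, ?a t)"
    by blast
  have "classes_generate G
      ((\<lambda>x. {a \<otimes>\<^bsub>G\<^esub> x \<otimes>\<^bsub>G\<^esub> inv\<^bsub>G\<^esub> a | a. a \<in> carrier G}) ` g ` {..<d})"
  proof (rule h.classes_generate_if_normal_closure[where Y = "g ` {..<d}"])
    fix N
    assume N: "N \<lhd> ?P \<times>\<times> ?A" and gN: "h ` g ` {..<d} \<subseteq> N"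
    interpret N: normal N "?P \<times>\<times> ?A" by (rule N)
    have aN: "(restrict s I, ?a t) \<in> N" if "t < d" for t
    proof -
      have "h (g t) \<in> N"
        using gN that by blast
      then show ?thesis
        by (simp only: g(2))
    qed
    have emb1: "group_hom ?P (?P \<times>\<times> ?A) (\<lambda>x. (x, \<one>\<^bsub>?A\<^esub>))"
      by (rule DirProd_embed_hom[OF P.group_axioms A.group_axioms])
    have emb2: "group_hom ?A (?P \<times>\<times> ?A) (\<lambda>x. (\<one>\<^bsub>?P\<^esub>, x))"
      by (rule DirProd_embed_hom[OF P.group_axioms A.group_axioms])
    have "(\<lambda>x. (x, \<one>\<^bsub>?A\<^esub>)) ` carrier ?P \<subseteq> N"
    \<comment> \<open>The pair with \<open>t = 0\<close> serves as \<open>q\<close>, available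
      because \<open>0 < d\<close>. Its second component commutes with the identity, so only the
      first matters.\<close>
    proof (rule nonabelian_product_in_normal[OF I S s emb1 N aN[OF d0]])
      fix x y
      assume "x \<in> carrier ?P" "y \<in> carrier ?P"
        and eq: "\<And>i. i \<in> I \<Longrightarrow> s i \<otimes>\<^bsub>S i\<^esub> x i = y i \<otimes>\<^bsub>S i\<^esub> s i"
      have "restrict s I \<otimes>\<^bsub>?P\<^esub> x = y \<otimes>\<^bsub>?P\<^esub> restrict s I"
        using eq by (auto intro!: restrict_ext)
      moreover have "?a 0 \<otimes>\<^bsub>?A\<^esub> \<one>\<^bsub>?A\<^esub> = \<one>\<^bsub>?A\<^esub> \<otimes>\<^bsub>?A\<^esub> ?a 0"
        by (simp only: A.l_one[OF aA] A.r_one[OF aA])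
      ultimately show "(restrict s I, ?a 0) \<otimes>\<^bsub>?P \<times>\<times> ?A\<^esub> (x, \<one>\<^bsub>?A\<^esub>) =
          (y, \<one>\<^bsub>?A\<^esub>) \<otimes>\<^bsub>?P \<times>\<times> ?A\<^esub> (restrict s I, ?a 0)"
        unfolding mult_DirProd by (rule arg_cong2[of _ _ _ _ Pair])
    qed
    then have PN: "(x, \<one>\<^bsub>?A\<^esub>) \<in> N" if "x \<in> carrier ?P" for x
      using that by blast
    have "{y \<in> carrier ?A. (\<one>\<^bsub>?P\<^esub>, y) \<in> N} = carrier ?A"
    proof (rule basis_vectors_generate[OF J prime inj d])
      show "subgroup {y \<in> carrier ?A. (\<one>\<^bsub>?P\<^esub>, y) \<in> N} ?A"
        by (rule group_hom.subgroup_preimage[OF emb2 N.subgroup_axioms])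
    next
      fix t
      assume t: "t < d"
      \<comment> \<open>The inverse of the first component already lies in \<open>N\<close>, so
        multiplying by it isolates the basis vector.\<close>
      have "(inv\<^bsub>?P\<^esub> restrict s I, \<one>\<^bsub>?A\<^esub>) \<otimes>\<^bsub>?P \<times>\<times> ?A\<^esub> (restrict s I, ?a t) \<in> N"
        by (rule N.m_closed[OF PN[OF P.inv_closed[OF sP]] aN[OF t]])
      then show "?a t \<in> {y \<in> carrier ?A. (\<one>\<^bsub>?P\<^esub>, y) \<in> N}"
        unfolding mult_DirProd P.l_inv[OF sP] A.l_one[OF aA] using aA by blast
    qed
    then have AN: "(\<one>\<^bsub>?P\<^esub>, y) \<in> N" if "y \<in> carrier ?A" for y
      using that by blast
    have "(x, y) \<in> N" if "x \<in> carrier ?P" "y \<in> carrier ?A" for x y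
    proof -
      have "(x, \<one>\<^bsub>?A\<^esub>) \<otimes>\<^bsub>?P \<times>\<times> ?A\<^esub> (\<one>\<^bsub>?P\<^esub>, y) \<in> N"
        by (rule N.m_closed[OF PN[OF that(1)] AN[OF that(2)]])
      then show ?thesis
        unfolding mult_DirProd P.r_one[OF that(1)] A.l_one[OF that(2)] .
    qed
    then have "carrier (?P \<times>\<times> ?A) \<subseteq> N"
      unfolding carrier_DirProd by blast
    with N.subset show "N = carrier (?P \<times>\<times> ?A)"
      by (rule equalityI)
  next
    show "g ` {..<d} \<subseteq> carrier G"
      using g(1) by blast
  qed (simp_all only: G h order_refl)
  moreover have "card ((\<lambda>x. {a \<otimes>\<^bsub>G\<^esub> x \<otimes>\<^bsub>G\<^esub> inv\<^bsub>G\<^esub> a | a. a \<in> carrier G}) ` g ` {..<d}) \<le> d"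
    unfolding image_comp using card_image_le[of "{..<d}"] by simp
  ultimately show ?thesis
    by blast
qed

text \<open>Projection onto factor \<open>j\<close> maps \<open>G\<close> onto an Abelian group of
  order \<open>ps j ^ ds j\<close> in which all \<open>ps j\<close>-th powers are trivial. Hence
  \<open>ps j ^ ds j\<close> is at most \<open>ps j ^ card \<C>\<close>, and exponents compare since
  the base exceeds 1.\<close>

lemma elementary_abelian_factor_bound:
  fixes S :: "'i \<Rightarrow> ('b, 'n) monoid_scheme" and ps ds :: "'j \<Rightarrow> nat"
  assumes G: "group G" "finite (carrier G)"
    and S: "\<And>i. i \<in> I \<Longrightarrow> group (S i)"
    and iso: "G Mod radical G \<cong>
      product_group I S \<times>\<times> product_group J (\<lambda>j. elementary_abelian_group (ps j) (ds j))"
    and j: "j \<in> J" and p: "1 < ps j" and gen: "classes_generate G \<C>"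
  shows "ds j \<le> card \<C>"
proof -
  let ?P = "product_group I S"
  let ?E = "\<lambda>j. elementary_abelian_group (ps j) (ds j)"
  let ?A = "product_group J ?E"
  have P: "group ?P" and A: "group ?A"
    using S by (simp_all add: elementary_abelian_group_simps)
  have Q: "group (?P \<times>\<times> ?A)"
    by (rule DirProd_group[OF P A])
  obtain h where h: "group_hom G (?P \<times>\<times> ?A) h" "h ` carrier G = carrier (?P \<times>\<times> ?A)"
      "kernel G (?P \<times>\<times> ?A) h = radical G"
    using group.radical_quotient_hom[OF G(1) iso Q] by blast
  define f where "f = (\<lambda>x. x j) \<circ> (snd \<circ> h)"
  have "snd \<circ> h \<in> hom G ?A"
    using group_hom.homh[OF h(1)] by (simp add: hom_pairwise)
  then have "f \<in> hom G (?E j)"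
    unfolding f_def using coord_proj_hom[OF j, of ?E] by (rule hom_compose)
  then have hom: "group_hom G (?E j) f"
    using G by (simp add: group_hom_def group_hom_axioms_def elementary_abelian_group_simps)
  \<comment> \<open>The second projection of a Cartesian product is onto only if the first factor is
    nonempty.\<close>
  have ne: "carrier ?P \<noteq> {}"
    using monoid.one_closed[OF group.is_monoid[OF P]] by blast
  have "f ` carrier G = (\<lambda>x. x j) ` snd ` carrier (?P \<times>\<times> ?A)"
    unfolding f_def image_comp[symmetric] h(2) ..
  also have "snd ` carrier (?P \<times>\<times> ?A) = carrier ?A"
    by (simp only: carrier_DirProd snd_image_times ne if_False)
  also have "(\<lambda>x. x j) ` carrier ?A = carrier (?E j)"
    by (rule coord_proj_surj) (simp_all add: elementary_abelian_group_simps j)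
  finally have "card (carrier (?E j)) \<le> ps j ^ card \<C>"
    using p
    by (intro group_hom.classes_generate_card_ge[OF hom elementary_abelian_group_simps(3)
          _ _ _ G(2) gen]) (simp_all add: elementary_abelian_group_pow)
  then show ?thesis
    using p by (simp add: card_elementary_abelian_group)
qed

theorem theorem3:
  fixes G :: "('a, 'm) monoid_scheme"
    and I :: "'i set" and S :: "'i \<Rightarrow> ('b, 'n) monoid_scheme"
    and k p d :: nat and ps ds :: "nat \<Rightarrow> nat"
  assumes "group G" and "finite (carrier G)"
    and "finite I" and "\<And>i. i \<in> I \<Longrightarrow> nonabelian_simple_group (S i)"
  shows "(G Mod radical G \<cong> product_group I S \<longrightarrow>
            (\<exists>C \<in> conjugacy_classes G. classes_generate G {C}))
       \<and> (k \<ge> 1 \<and> (\<forall>j \<in> {1..k}. Factorial_Ring.prime (ps j) \<and> ds j \<ge> 1) \<and> inj_on ps {1..k} \<and>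
          G Mod radical G \<cong>
            product_group I S \<times>\<times>
            product_group {1..k} (\<lambda>j. elementary_abelian_group (ps j) (ds j)) \<and>
          (\<exists>j \<in> {1..k}. p = ps j \<and> d = ds j) \<and> d = Max (ds ` {1..k}) \<longrightarrow>
            (\<exists>\<C>. classes_generate G \<C> \<and> card \<C> = d) \<and>
            (\<forall>\<C>. classes_generate G \<C> \<longrightarrow> d \<le> card \<C>))"
\<comment> \<open>The instantiation splits only the conjunction of the two implications, not the one
  inside the conclusion of (b).\<close>
proof (intro conjI[of "_ \<longrightarrow> _" "_ \<longrightarrow> _"] impI)
  assume "G Mod radical G \<cong> product_group I S"
  with assms show "\<exists>C \<in> conjugacy_classes G. classes_generate G {C}"
    by (rule nonabelian_case)
next
  assume asm: "k \<ge> 1 \<and> (\<forall>j \<in> {1..k}. Factorial_Ring.prime (ps j) \<and> ds j \<ge> 1) \<and> inj_on ps {1..k} \<and>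
    G Mod radical G \<cong>
      product_group I S \<times>\<times>
      product_group {1..k} (\<lambda>j. elementary_abelian_group (ps j) (ds j)) \<and>
    (\<exists>j \<in> {1..k}. p = ps j \<and> d = ds j) \<and> d = Max (ds ` {1..k})"
  then obtain j where j: "j \<in> {1..k}" "d = ds j"
    by blast
  have iso: "G Mod radical G \<cong> product_group I S \<times>\<times>
      product_group {1..k} (\<lambda>j. elementary_abelian_group (ps j) (ds j))"
    using asm by blast
  have d: "ds i \<le> d" if "i \<in> {1..k}" for i
    using asm that by simp
  have p: "1 < ps j"
    using asm j(1) prime_gt_1_nat by blast
  have lower: "d \<le> card \<C>" if "classes_generate G \<C>" for \<C>
    unfolding j(2)
    by (rule elementary_abelian_factor_bound[OF assms(1,2) _ iso j(1) p that])
      (rule nonabelian_simple_groupD(2)[OF assms(4)])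
  have prime: "Factorial_Ring.prime (ps i)" if "i \<in> {1..k}" for i
    using asm that by blast
  have inj: "inj_on ps {1..k}" and d0: "0 < d"
    using asm by auto
  have "\<exists>\<C>. classes_generate G \<C> \<and> card \<C> \<le> d"
    by (rule mixed_case_classes[OF assms finite_atLeastAtMost prime inj d d0 iso])
  \<comment> \<open>The lower bound, applied to the family just found, turns its bound
    \<open>d\<close> into equality.\<close>
  with lower show "(\<exists>\<C>. classes_generate G \<C> \<and> card \<C> = d) \<and>
      (\<forall>\<C>. classes_generate G \<C> \<longrightarrow> d \<le> card \<C>)"
    using le_antisym by blast
qed

end
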